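(* Let $w^0,w^1,w^2,\dots:\mathbb{I}\to[0,1]$ be arbitrary weight functions, let $x^0\in\mathbb{R}^n$ be arbitrary, and let $x^{k+1}=\sum_{\iota\in\mathbb{I}}w^k(\iota)P[\iota](x^k)$ for all $k\ge 0$. Suppose $\mathbf{UASC}(\mathcal{C})$ holds. Then the sequence $x^0,x^1,x^2,\dots$ converges, and its limit lies in $C_j$ for every index $j$ such that $\sum_{k=0}^{\infty}\sum_{\iota\in\mathbb{I}\langle j\rangle}w^k(\iota)=\infty$. In particular, the sequence $x^0,x^1,x^2,\dots$ converges to a point in $\bigcap\mathcal{C}$ if $\sum_{k=0}^{\infty}\sum_{\iota\in\mathbb{I}\langle j\rangle}w^k(\iota)=\infty$ for every index $j$ such that $C_j\neq\mathbb{R}^n$.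
   Context: Fix a positive integer $n$ and an infinite sequence $C_1,C_2,C_3,\dots$ of closed convex subsets of $\mathbb{R}^n$ such that $\bigcap_{i=1}^\infty C_i\neq\emptyset$ and at least one $C_i$ is not $\mathbb{R}^n$. Write $\mathcal{C}=\{C_i\mid 1\le i<\infty\}$, so $\bigcap\mathcal{C}=\bigcap_{i=1}^\infty C_i$. For $q\in\mathbb{R}^n$ and nonempty $Z\subseteq\mathbb{R}^n$, $d(q,Z)=\inf_{z\in Z}\|q-z\|$ (Euclidean norm). An index is a positive integer. For each index $j$, $P_j:\mathbb{R}^n\to C_j$ maps each $q$ to the unique point of $C_j$ closest to $q$. The condition $\mathbf{UASC}(\mathcal{C})$ is: $d\left(p,\bigcup\{C\in\mathcal{C}\mid p\notin C\}\right)>0$ for all $p\in\mathbb{R}^n\setminus\bigcap\mathcal{C}$. $\mathbb{I}$ is the set of all nonempty finite sequences of indices (repetitions allowed); its members are called index vectors. For $\iota=(\iota_1,\dots,\iota_m)\in\mathbb{I}$, $P[\iota]=P_{\iota_m}\circ P_{\iota_{m-1}}\circ\dots\circ P_{\iota_1}$. For an index $j$, $\mathbb{I}\langle j\rangle$ is the set of index vectors in which $j$ occurs. A weight function is a function $w:\mathbb{I}\to[0,1]$ with finite support such that $\sum_{\iota\in\mathbb{I}}w(\iota)=1$. *)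

theory Defs
  imports "HOL-Analysis.Analysis"
begin

text \<open>Indices are positive integers: a sequence of sets is a function on \<^typ>\<open>nat\<close> whose value at 0
  is never used.\<close>

definition family :: "(nat \<Rightarrow> 'a set) \<Rightarrow> 'a set set" where
  "family C = {C i | i. 1 \<le> i}"

text \<open>For \<open>p \<notin> \<Inter>\<C>\<close> some member of \<open>\<C>\<close> misses \<open>p\<close>. If the members are nonempty, the union below is
  nonempty, so the convention \<open>infdist p {} = 0\<close> plays no role.\<close>

definition UASC :: "'a::metric_space set set \<Rightarrow> bool" where
  "UASC \<C> \<longleftrightarrow> (\<forall>p \<in> UNIV - \<Inter>\<C>. infdist p (\<Union>{C \<in> \<C>. p \<notin> C}) > 0)"

definition index_vectors :: "nat list set" where
  "index_vectors = {\<iota>. \<iota> \<noteq> [] \<and> (\<forall>j \<in> set \<iota>. 1 \<le> j)}"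

definition index_vectors_with :: "nat \<Rightarrow> nat list set" where
  "index_vectors_with j = {\<iota> \<in> index_vectors. j \<in> set \<iota>}"

text \<open>\<^const>\<open>fold\<close> applies the projection of the head of the list first, so for
  \<open>\<iota> = [\<iota>\<^sub>1, \<dots>, \<iota>\<^sub>m]\<close> this is the composition of the projections with that of \<open>\<iota>\<^sub>m\<close> outermost.\<close>

definition proj_along :: "(nat \<Rightarrow> 'a::euclidean_space set) \<Rightarrow> nat list \<Rightarrow> 'a \<Rightarrow> 'a" where
  "proj_along C \<iota> = fold (\<lambda>j. closest_point (C j)) \<iota>"

text \<open>Values of \<open>w\<close> outside \<^const>\<open>index_vectors\<close> are never used. As \<^const>\<open>sum\<close> is 0 on infinite sets,
  sums over index vectors are restricted to the support of \<open>w\<close>.\<close>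

definition wsupport :: "(nat list \<Rightarrow> real) \<Rightarrow> nat list set" where
  "wsupport w = {\<iota> \<in> index_vectors. w \<iota> \<noteq> 0}"

definition weight_function :: "(nat list \<Rightarrow> real) \<Rightarrow> bool" where
  "weight_function w \<longleftrightarrow>
     (\<forall>\<iota> \<in> index_vectors. 0 \<le> w \<iota> \<and> w \<iota> \<le> 1) \<and>
     finite (wsupport w) \<and> (\<Sum>\<iota> \<in> wsupport w. w \<iota>) = 1"

definition index_weight :: "(nat list \<Rightarrow> real) \<Rightarrow> nat \<Rightarrow> real" where
  "index_weight w j = (\<Sum>\<iota> \<in> wsupport w \<inter> index_vectors_with j. w \<iota>)"

end

theory Submission
  imports Defs
begin

text \<open>
  Projecting onto a closed convex set that contains a point brings every other point at least as
  close to it. Hence, for a common point \<open>z\<close> of all the sets, \<open>(dist (x k) z)\<^sup>2\<close> never increases, and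
  its total decrease over all steps is finite. The bounded sequence \<open>x\<close> has a cluster point \<open>p\<close>, and
  \<open>UASC\<close> gives an \<open>\<epsilon> > 0\<close> such that every set missing \<open>p\<close> stays at distance \<open>\<epsilon>\<close> from \<open>p\<close>.

  Call an index vector \<^emph>\<open>stray\<close> if it uses a set that misses \<open>p\<close>. As long as the iterate is within
  \<open>\<epsilon> / 2\<close> of \<open>p\<close>, a non-stray index vector does not increase the distance to \<open>p\<close>, whereas a stray one
  must in one of its projections travel a distance of \<open>\<epsilon> / 2\<close>, which by firm nonexpansiveness lowers the squared
  distance to \<open>z\<close> by \<open>(\<epsilon> / 2)\<^sup>2\<close>. So the total weight of the stray vectors is at most a constant times
  the decrease of \<open>(dist (x k) z)\<^sup>2\<close> (lemma \<open>stray_weight_le_decrease\<close>), and the distance to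
  \<open>p\<close> grows by at most a constant times that weight (lemma \<open>dist_step_le_stray_weight\<close>). Once the
  iterate is close to \<open>p\<close> and little of the decrease is left, it can never leave a small
  neighbourhood of \<open>p\<close>; therefore \<open>x\<close> converges to \<open>p\<close> (lemma \<open>converges_to_cluster_point\<close>).

  Finally, if the limit misses \<open>C j\<close>, then all index vectors containing \<open>j\<close> are stray, and the weight
  of the stray vectors is summable by the same estimate, so the total weight of \<open>j\<close> is finite.
\<close>

section \<open>Compositions of projections\<close>

text \<open>Firm nonexpansiveness relative to a point of the set: the angle at the projection between \<open>x\<close>
  and \<open>z\<close> is at least a right angle, so Pythagoras becomes an inequality.\<close>

lemma closest_point_pythagoras_le:
  fixes S :: "'a::euclidean_space set"
  assumes "closed S" "convex S" "z \<in> S"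
  shows "(dist (closest_point S x) z)\<^sup>2 + (dist x (closest_point S x))\<^sup>2 \<le> (dist x z)\<^sup>2"
proof -
  let ?c = "closest_point S x"
  have "inner (x - ?c) (z - ?c) \<le> 0"
    using closest_point_dot[OF assms(2,1,3)] .
  moreover have "(dist x z)\<^sup>2 = (dist ?c z)\<^sup>2 + (dist x ?c)\<^sup>2 - 2 * inner (x - ?c) (z - ?c)"
    by (simp add: dist_norm power2_norm_eq_inner inner_diff_left inner_diff_right inner_commute)
  ultimately show ?thesis by linarith
qed

lemma dist_closest_point_le:
  fixes S :: "'a::euclidean_space set"
  assumes "closed S" "convex S" "z \<in> S"
  shows "dist (closest_point S x) z \<le> dist x z"
  using closest_point_lipschitz[OF assms(2,1), of x z] closest_point_self[OF assms(3)] assms(3)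
  by auto

lemma dist_proj_along_le:
  fixes C :: "nat \<Rightarrow> 'a::euclidean_space set"
  assumes "\<And>j. j \<in> set \<iota> \<Longrightarrow> closed (C j) \<and> convex (C j) \<and> z \<in> C j"
  shows "dist (proj_along C \<iota> x) z \<le> dist x z"
  using assms
proof (induction \<iota> arbitrary: x)
  case Nil
  then show ?case by (simp add: proj_along_def)
next
  case (Cons i \<iota>)
  have "dist (proj_along C (i # \<iota>) x) z \<le> dist (closest_point (C i) x) z"
    using Cons by (simp add: proj_along_def)
  also have "\<dots> \<le> dist x z"
    using Cons.prems[of i] by (intro dist_closest_point_le) auto
  finally show ?case .
qed

text \<open>Up to the first projection onto a set that misses \<open>p\<close>, the moving point stays within \<open>\<delta>\<close> of \<open>p\<close>;
  that projection then carries it over a distance of at least \<open>\<epsilon> - \<delta>\<close>, and the remaining ones do no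
  harm.\<close>

lemma dist_proj_along_stray_le:
  fixes C :: "nat \<Rightarrow> 'a::euclidean_space set"
  assumes "\<And>j. j \<in> set \<iota> \<Longrightarrow> closed (C j) \<and> convex (C j) \<and> z \<in> C j"
    and "\<And>j y. j \<in> set \<iota> \<Longrightarrow> p \<notin> C j \<Longrightarrow> y \<in> C j \<Longrightarrow> \<epsilon> \<le> dist p y"
    and "\<exists>j \<in> set \<iota>. p \<notin> C j"
    and "dist x p \<le> \<delta>" "\<delta> \<le> \<epsilon>"
  shows "(dist (proj_along C \<iota> x) z)\<^sup>2 \<le> (dist x z)\<^sup>2 - (\<epsilon> - \<delta>)\<^sup>2"
  using assms
proof (induction \<iota> arbitrary: x)
  case Nil
  then show ?case by simp
next
  case (Cons i \<iota>)
  let ?c = "closest_point (C i) x"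
  have Ci: "closed (C i)" "convex (C i)" "z \<in> C i"
    using Cons.prems(1)[of i] by auto
  have first: "(dist ?c z)\<^sup>2 + (dist x ?c)\<^sup>2 \<le> (dist x z)\<^sup>2"
    using closest_point_pythagoras_le[OF Ci] .
  have tail: "proj_along C (i # \<iota>) x = proj_along C \<iota> ?c"
    by (simp add: proj_along_def)
  show ?case
  proof (cases "p \<in> C i")
    case True
    have "dist ?c p \<le> \<delta>"
      using dist_closest_point_le[OF Ci(1,2) True, of x] Cons.prems(4) by linarith
    then have "(dist (proj_along C \<iota> ?c) z)\<^sup>2 \<le> (dist ?c z)\<^sup>2 - (\<epsilon> - \<delta>)\<^sup>2"
      using Cons.prems True by (intro Cons.IH) auto
    then show ?thesis
      using first zero_le_power2[of "dist x ?c"] unfolding tail by linarith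
  next
    case False
    have "?c \<in> C i"
      using closest_point_in_set Ci by blast
    then have "\<epsilon> \<le> dist p ?c"
      using Cons.prems(2)[of i] False by auto
    then have "\<epsilon> - \<delta> \<le> dist x ?c"
      using Cons.prems(4) dist_triangle[of p ?c x] by (simp add: dist_commute)
    then have "(\<epsilon> - \<delta>)\<^sup>2 \<le> (dist x ?c)\<^sup>2"
      using Cons.prems(5) by (intro power_mono) auto
    moreover have "(dist (proj_along C \<iota> ?c) z)\<^sup>2 \<le> (dist ?c z)\<^sup>2"
      using Cons.prems(1) by (intro power_mono dist_proj_along_le) auto
    ultimately show ?thesis
      using first unfolding tail by linarith
  qed
qed

section \<open>Averaging over index vectors\<close>

lemma weight_functionD:
  assumes "weight_function w"
  shows "finite (wsupport w)" "(\<Sum>\<iota> \<in> wsupport w. w \<iota>) = 1" "wsupport w \<noteq> {}"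
    and "\<And>\<iota>. \<iota> \<in> wsupport w \<Longrightarrow> 0 \<le> w \<iota>"
proof -
  show "finite (wsupport w)" and sum: "(\<Sum>\<iota> \<in> wsupport w. w \<iota>) = 1"
    and "\<And>\<iota>. \<iota> \<in> wsupport w \<Longrightarrow> 0 \<le> w \<iota>"
    using assms by (auto simp: weight_function_def wsupport_def)
  show "wsupport w \<noteq> {}"
    using sum by auto
qed

lemma convex_weighted_average_le:
  assumes "weight_function w" "convex_on UNIV f"
  shows "f (\<Sum>\<iota> \<in> wsupport w. w \<iota> *\<^sub>R v \<iota>) \<le> (\<Sum>\<iota> \<in> wsupport w. w \<iota> * f (v \<iota>))"
  using weight_functionD[OF assms(1)] assms(2) by (intro convex_on_sum) auto

lemma convex_on_dist_power2:
  fixes z :: "'a::real_normed_vector"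
  shows "convex_on UNIV (\<lambda>y. (dist y z)\<^sup>2)"
proof (rule convex_onI)
  fix t :: real and x y :: 'a
  assume t: "0 < t" "t < 1"
  have "dist ((1 - t) *\<^sub>R x + t *\<^sub>R y) z \<le> (1 - t) * dist x z + t * dist y z"
    using convex_onD[OF convex_on_dist[of UNIV z], of t x y] t by (simp add: dist_commute)
  then have "(dist ((1 - t) *\<^sub>R x + t *\<^sub>R y) z)\<^sup>2 \<le> ((1 - t) * dist x z + t * dist y z)\<^sup>2"
    by (intro power_mono) auto
  also have "\<dots> \<le> (1 - t) * (dist x z)\<^sup>2 + t * (dist y z)\<^sup>2"
    using convex_onD[OF convex_power2, of t "dist x z" "dist y z"] t by simp
  finally show "(dist ((1 - t) *\<^sub>R x + t *\<^sub>R y) z)\<^sup>2 \<le> (1 - t) * (dist x z)\<^sup>2 + t * (dist y z)\<^sup>2" .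
qed simp

lemma weighted_average_le:
  assumes "weight_function w"
    and "\<And>\<iota>. \<iota> \<in> wsupport w \<Longrightarrow> \<iota> \<notin> S \<Longrightarrow> f \<iota> \<le> a"
    and "\<And>\<iota>. \<iota> \<in> wsupport w \<Longrightarrow> \<iota> \<in> S \<Longrightarrow> f \<iota> \<le> a + c"
  shows "(\<Sum>\<iota> \<in> wsupport w. w \<iota> * f \<iota>) \<le> a + c * (\<Sum>\<iota> \<in> wsupport w \<inter> S. w \<iota>)"
proof -
  note w = weight_functionD[OF assms(1)]
  have "(\<Sum>\<iota> \<in> wsupport w. w \<iota> * f \<iota>)
      \<le> (\<Sum>\<iota> \<in> wsupport w. w \<iota> * a + (if \<iota> \<in> S then w \<iota> * c else 0))"
    using assms(2,3) w(4) by (intro sum_mono) (auto simp: mult_left_mono simp flip: distrib_left)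
  also have "\<dots> = (\<Sum>\<iota> \<in> wsupport w. w \<iota>) * a + (\<Sum>\<iota> \<in> wsupport w \<inter> S. w \<iota> * c)"
    using w(1) by (simp add: sum.distrib sum_distrib_right sum.inter_restrict)
  also have "\<dots> = a + c * (\<Sum>\<iota> \<in> wsupport w \<inter> S. w \<iota>)"
    using w(2) by (simp add: sum_distrib_left mult.commute)
  finally show ?thesis .
qed

section \<open>The averaged iteration\<close>

text \<open>What \<^const>\<open>UASC\<close> says about a single point: the sets missing it keep a common positive
  distance. It
  also holds for points that no set misses, so that cluster points in and outside \<open>\<Inter>(family C)\<close> can
  be treated alike.\<close>

definition isolated_from_missing :: "(nat \<Rightarrow> 'a::metric_space set) \<Rightarrow> 'a \<Rightarrow> real \<Rightarrow> bool" where
  "isolated_from_missing C p \<epsilon> \<longleftrightarrow> 0 < \<epsilon> \<and> (\<forall>j\<ge>1. p \<notin> C j \<longrightarrow> (\<forall>y \<in> C j. \<epsilon> \<le> dist p y))"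

lemma UASC_imp_isolated_from_missing:
  assumes "UASC (family C)"
  obtains \<epsilon> where "isolated_from_missing C p \<epsilon>"
proof (cases "p \<in> \<Inter>(family C)")
  case True
  then have "isolated_from_missing C p 1"
    by (auto simp: isolated_from_missing_def family_def)
  then show ?thesis by (rule that)
next
  case False
  let ?U = "\<Union>{D \<in> family C. p \<notin> D}"
  have "0 < infdist p ?U"
    using assms False by (auto simp: UASC_def)
  moreover have "infdist p ?U \<le> dist p y" if "1 \<le> j" "p \<notin> C j" "y \<in> C j" for j y
    using that by (intro infdist_le) (auto simp: family_def)
  ultimately have "isolated_from_missing C p (infdist p ?U)"
    by (auto simp: isolated_from_missing_def)
  then show ?thesis by (rule that)
qed

definition stray_weight :: "(nat \<Rightarrow> 'a set) \<Rightarrow> (nat list \<Rightarrow> real) \<Rightarrow> 'a \<Rightarrow> real" where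
  "stray_weight C w p = (\<Sum>\<iota> \<in> wsupport w \<inter> {\<iota>. \<exists>j \<in> set \<iota>. p \<notin> C j}. w \<iota>)"

locale averaged_projections =
  fixes C :: "nat \<Rightarrow> 'a::euclidean_space set"
    and w :: "nat \<Rightarrow> nat list \<Rightarrow> real"
    and x :: "nat \<Rightarrow> 'a"
    and z :: 'a
  assumes closed: "1 \<le> i \<Longrightarrow> closed (C i)"
    and convex: "1 \<le> i \<Longrightarrow> convex (C i)"
    and common: "1 \<le> i \<Longrightarrow> z \<in> C i"
    and weights: "weight_function (w k)"
    and step: "x (Suc k) = (\<Sum>\<iota> \<in> wsupport (w k). w k \<iota> *\<^sub>R proj_along C \<iota> (x k))"
begin

lemma index_pos: "\<iota> \<in> wsupport (w k) \<Longrightarrow> j \<in> set \<iota> \<Longrightarrow> 1 \<le> j"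
  by (auto simp: wsupport_def index_vectors_def)

lemma dist_proj_along_common_le:
  "\<iota> \<in> wsupport (w k) \<Longrightarrow> dist (proj_along C \<iota> y) z \<le> dist y z"
  using index_pos closed convex common by (intro dist_proj_along_le) blast

lemma decseq_dist_common: "decseq (\<lambda>k. dist (x k) z)"
proof (rule decseq_SucI)
  fix k
  have "dist (x (Suc k)) z \<le> (\<Sum>\<iota> \<in> wsupport (w k). w k \<iota> * dist (proj_along C \<iota> (x k)) z)"
    using convex_weighted_average_le[OF weights[of k] convex_on_dist[of UNIV z]]
    by (simp add: step dist_commute)
  also have "\<dots> \<le> dist (x k) z"
    using weighted_average_le[OF weights[of k], of "{}" _ "dist (x k) z"] dist_proj_along_common_le
    by simp
  finally show "dist (x (Suc k)) z \<le> dist (x k) z" .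
qed

lemma dist_common_le_initial: "dist (x k) z \<le> dist (x 0) z"
  using decseqD[OF decseq_dist_common] by simp

lemma stray_weight_nonneg: "0 \<le> stray_weight C (w k) p"
  unfolding stray_weight_def using weight_functionD(4)[OF weights] by (intro sum_nonneg) auto

text \<open>No index vector takes the iterate farther from \<open>z\<close> than \<open>x 0\<close>, which bounds the harm that a stray
  one can do; the others consist of projections onto sets containing \<open>p\<close>.\<close>

lemma dist_step_le_stray_weight:
  "dist (x (Suc k)) p \<le> dist (x k) p + (dist (x 0) z + dist z p) * stray_weight C (w k) p"
proof -
  let ?S = "{\<iota>. \<exists>j \<in> set \<iota>. p \<notin> C j}"
  have "dist (x (Suc k)) p \<le> (\<Sum>\<iota> \<in> wsupport (w k). w k \<iota> * dist (proj_along C \<iota> (x k)) p)"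
    using convex_weighted_average_le[OF weights[of k] convex_on_dist[of UNIV p]]
    by (simp add: step dist_commute)
  also have "\<dots> \<le> dist (x k) p + (dist (x 0) z + dist z p) * stray_weight C (w k) p"
    unfolding stray_weight_def
  proof (rule weighted_average_le[OF weights])
    fix \<iota> assume \<iota>: "\<iota> \<in> wsupport (w k)"
    show "dist (proj_along C \<iota> (x k)) p \<le> dist (x k) p" if "\<iota> \<notin> ?S"
      using that index_pos[OF \<iota>] closed convex by (intro dist_proj_along_le) blast
    show "dist (proj_along C \<iota> (x k)) p \<le> dist (x k) p + (dist (x 0) z + dist z p)"
      using dist_triangle[of "proj_along C \<iota> (x k)" p z] dist_proj_along_common_le[OF \<iota>, of "x k"]
        dist_common_le_initial[of k] zero_le_dist[of "x k" p]
      by linarith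
  qed
  finally show ?thesis .
qed

text \<open>The radius \<open>\<epsilon> / 2\<close> leaves a distance of at least \<open>\<epsilon> / 2\<close> to be covered by every stray index
  vector.\<close>

lemma stray_weight_le_decrease:
  assumes "isolated_from_missing C p \<epsilon>" "dist (x k) p \<le> \<epsilon> / 2"
  shows "stray_weight C (w k) p \<le> 4 / \<epsilon>\<^sup>2 * ((dist (x k) z)\<^sup>2 - (dist (x (Suc k)) z)\<^sup>2)"
proof -
  let ?S = "{\<iota>. \<exists>j \<in> set \<iota>. p \<notin> C j}"
  have eps: "0 < \<epsilon>" using assms(1) by (simp add: isolated_from_missing_def)
  have "(dist (x (Suc k)) z)\<^sup>2
      \<le> (\<Sum>\<iota> \<in> wsupport (w k). w k \<iota> * (dist (proj_along C \<iota> (x k)) z)\<^sup>2)"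
    using convex_weighted_average_le[OF weights convex_on_dist_power2] by (simp add: step)
  also have "\<dots> \<le> (dist (x k) z)\<^sup>2 + (- (\<epsilon> - \<epsilon> / 2)\<^sup>2) * stray_weight C (w k) p"
    unfolding stray_weight_def
  proof (rule weighted_average_le[OF weights])
    fix \<iota> assume \<iota>: "\<iota> \<in> wsupport (w k)"
    show "(dist (proj_along C \<iota> (x k)) z)\<^sup>2 \<le> (dist (x k) z)\<^sup>2"
      using dist_proj_along_common_le[OF \<iota>] by (intro power_mono) auto
    have "(dist (proj_along C \<iota> (x k)) z)\<^sup>2 \<le> (dist (x k) z)\<^sup>2 - (\<epsilon> - \<epsilon> / 2)\<^sup>2" if "\<iota> \<in> ?S"
    proof (rule dist_proj_along_stray_le)
      show "\<And>j. j \<in> set \<iota> \<Longrightarrow> closed (C j) \<and> convex (C j) \<and> z \<in> C j"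
        using index_pos[OF \<iota>] closed convex common by blast
      show "\<And>j y. j \<in> set \<iota> \<Longrightarrow> p \<notin> C j \<Longrightarrow> y \<in> C j \<Longrightarrow> \<epsilon> \<le> dist p y"
        using index_pos[OF \<iota>] assms(1) by (auto simp: isolated_from_missing_def)
    qed (use that assms(2) eps in auto)
    then show "(dist (proj_along C \<iota> (x k)) z)\<^sup>2 \<le> (dist (x k) z)\<^sup>2 + - (\<epsilon> - \<epsilon> / 2)\<^sup>2" if "\<iota> \<in> ?S"
      using that by simp
  qed
  finally have "stray_weight C (w k) p * (\<epsilon>\<^sup>2 / 4) \<le> (dist (x k) z)\<^sup>2 - (dist (x (Suc k)) z)\<^sup>2"
    by (simp add: power_divide mult.commute)
  then show ?thesis
    using eps by (simp add: pos_le_divide_eq mult.commute)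
qed

text \<open>While the iterate is near \<open>p\<close>, the potential \<open>dist (x k) p + K * (dist (x k) z)\<^sup>2\<close> cannot increase
  if the constant \<open>K\<close> is large enough. Its second summand converges. Hence, if the iterate comes very
  close to \<open>p\<close> at a late time, the first summand stays small from then on, and this in turn keeps the
  iterate near \<open>p\<close>.\<close>

lemma converges_to_cluster_point:
  assumes gap: "isolated_from_missing C p \<epsilon>"
    and r: "strict_mono r" "(x \<circ> r) \<longlonglongrightarrow> p"
  shows "x \<longlonglongrightarrow> p"
proof (rule LIMSEQ_I)
  fix \<eta>' :: real assume "0 < \<eta>'"
  have eps: "0 < \<epsilon>" using gap by (simp add: isolated_from_missing_def)
  define \<eta> where "\<eta> = min \<eta>' (\<epsilon> / 2)"
  have \<eta>: "0 < \<eta>" "\<eta> \<le> \<eta>'" "\<eta> \<le> \<epsilon> / 2"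
    using \<open>0 < \<eta>'\<close> eps by (auto simp: \<eta>_def)
  define a where "a k = (dist (x k) z)\<^sup>2" for k
  define K where "K = (dist (x 0) z + dist z p) * (4 / \<epsilon>\<^sup>2)"
  have K: "0 \<le> K" by (simp add: K_def)
  have "decseq a"
    using decseq_dist_common by (auto simp: a_def decseq_def intro!: power_mono)
  then obtain A where A: "a \<longlonglongrightarrow> A" "\<forall>k. A \<le> a k"
    using decseq_convergent[of a 0] by (auto simp: a_def)
  have "(\<lambda>k. x (r k)) \<longlonglongrightarrow> p" "(\<lambda>k. a (r k)) \<longlonglongrightarrow> A"
    using r(2) LIMSEQ_subseq_LIMSEQ[OF A(1) r(1)] by (simp_all add: o_def)
  then have "(\<lambda>k. dist (x (r k)) p + K * (a (r k) - A)) \<longlonglongrightarrow> dist p p + K * (A - A)"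
    by (intro tendsto_intros)
  then have "\<forall>\<^sub>F k in sequentially. dist (x (r k)) p + K * (a (r k) - A) < \<eta>"
    using order_tendstoD(2)[of _ 0 _ \<eta>] \<eta>(1) by simp
  then obtain N where N: "dist (x N) p + K * (a N - A) < \<eta>"
    using eventually_happens by force
  have near: "dist (x k) p < \<eta>" if "dist (x k) p + K * a k \<le> dist (x N) p + K * a N" for k
    using that N mult_left_mono[OF A(2)[rule_format, of k] K] by (simp add: algebra_simps)
  have potential: "dist (x k) p + K * a k \<le> dist (x N) p + K * a N" if "N \<le> k" for k
    using that
  proof (induction k rule: dec_induct)
    case base
    show ?case by simp
  next
    case (step k)
    have "dist (x (Suc k)) p
        \<le> dist (x k) p + (dist (x 0) z + dist z p) * stray_weight C (w k) p"
      by (rule dist_step_le_stray_weight)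
    also have "\<dots> \<le> dist (x k) p + (dist (x 0) z + dist z p) * (4 / \<epsilon>\<^sup>2 * (a k - a (Suc k)))"
      unfolding a_def using near[OF step.IH] \<eta>(3)
      by (intro add_left_mono mult_left_mono stray_weight_le_decrease[OF gap]) auto
    also have "\<dots> = dist (x k) p + K * (a k - a (Suc k))"
      by (simp only: K_def mult.assoc)
    finally show ?case
      using step.IH by (simp add: algebra_simps)
  qed
  have "\<forall>k\<ge>N. norm (x k - p) < \<eta>'"
    using near[OF potential] \<eta>(2) by (auto simp: dist_norm intro: less_le_trans)
  then show "\<exists>N. \<forall>k\<ge>N. norm (x k - p) < \<eta>'" by blast
qed

lemma convergent_if_isolated_from_missing:
  assumes "\<And>p. \<exists>\<epsilon>. isolated_from_missing C p \<epsilon>"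
  obtains l where "x \<longlonglongrightarrow> l"
proof -
  have "\<forall>k. x k \<in> cball z (dist (x 0) z)"
    using dist_common_le_initial by (simp add: dist_commute)
  then obtain p r where "strict_mono r" "(x \<circ> r) \<longlonglongrightarrow> p"
    using compact_cball[of z "dist (x 0) z"] unfolding compact_def by metis
  then show ?thesis
    using converges_to_cluster_point assms that by metis
qed

lemma index_weight_nonneg: "0 \<le> index_weight (w k) j"
  unfolding index_weight_def using weight_functionD(4)[OF weights] by (intro sum_nonneg) auto

lemma index_weight_le_stray_weight:
  "p \<notin> C j \<Longrightarrow> index_weight (w k) j \<le> stray_weight C (w k) p"
  unfolding index_weight_def stray_weight_def using weight_functionD[OF weights]
  by (intro sum_mono2) (auto simp: index_vectors_with_def)

text \<open>Near the limit, the weights are dominated by a telescoping series.\<close>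

lemma summable_index_weight:
  assumes "x \<longlonglongrightarrow> l" "isolated_from_missing C l \<epsilon>" "l \<notin> C j"
  shows "summable (\<lambda>k. index_weight (w k) j)"
proof -
  have "0 < \<epsilon> / 2" using assms(2) by (simp add: isolated_from_missing_def)
  then have "\<forall>\<^sub>F k in sequentially. dist (x k) l < \<epsilon> / 2"
    using assms(1) tendstoD by blast
  then have dominated: "\<forall>\<^sub>F k in sequentially. norm (index_weight (w k) j)
      \<le> 4 / \<epsilon>\<^sup>2 * ((dist (x k) z)\<^sup>2 - (dist (x (Suc k)) z)\<^sup>2)"
  proof eventually_elim
    case (elim k)
    then show ?case
      using stray_weight_le_decrease[OF assms(2), of k] index_weight_nonneg[of k j]
        index_weight_le_stray_weight[OF assms(3), of k]
      by simp
  qed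
  have "(\<lambda>k. (dist (x k) z)\<^sup>2) \<longlonglongrightarrow> (dist l z)\<^sup>2"
    by (intro tendsto_intros assms(1))
  then show ?thesis
    using summable_comparison_test_ev[OF dominated] summable_mult telescope_summable' by blast
qed

lemma limit_mem_if_infinite_weight:
  assumes "x \<longlonglongrightarrow> l" "isolated_from_missing C l \<epsilon>"
    and "(\<Sum>k. ennreal (index_weight (w k) j)) = \<infinity>"
  shows "l \<in> C j"
proof (rule ccontr)
  assume "l \<notin> C j"
  from suminf_ennreal2[OF index_weight_nonneg summable_index_weight[OF assms(1,2) this]] assms(3)
  show False by simp
qed

end

section \<open>Convergence\<close>

theorem theorem4p1:
  fixes C :: "nat \<Rightarrow> (real ^ 'n) set"
    and w :: "nat \<Rightarrow> nat list \<Rightarrow> real"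
    and x :: "nat \<Rightarrow> real ^ 'n"
  assumes closed: "\<And>i. 1 \<le> i \<Longrightarrow> closed (C i)"
    and convex: "\<And>i. 1 \<le> i \<Longrightarrow> convex (C i)"
    and nonempty: "\<Inter>(family C) \<noteq> {}"
    and nontrivial: "\<exists>i\<ge>1. C i \<noteq> UNIV"
    and weights: "\<And>k. weight_function (w k)"
    and step: "\<And>k. x (Suc k) = (\<Sum>\<iota> \<in> wsupport (w k). w k \<iota> *\<^sub>R proj_along C \<iota> (x k))"
    and uasc: "UASC (family C)"
  shows "(\<exists>l. x \<longlonglongrightarrow> l \<and>
            (\<forall>j\<ge>1. (\<Sum>k. ennreal (index_weight (w k) j)) = \<infinity> \<longrightarrow> l \<in> C j)) \<and>
         ((\<forall>j\<ge>1. C j \<noteq> UNIV \<longrightarrow> (\<Sum>k. ennreal (index_weight (w k) j)) = \<infinity>) \<longrightarrow>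
            (\<exists>l \<in> \<Inter>(family C). x \<longlonglongrightarrow> l))"
proof -
  obtain z where "z \<in> \<Inter>(family C)"
    using nonempty by auto
  then interpret averaged_projections C w x z
    using closed convex weights step by unfold_locales (auto simp: family_def)
  have isolated: "\<exists>\<epsilon>. isolated_from_missing C p \<epsilon>" for p
    using UASC_imp_isolated_from_missing[OF uasc] by metis
  obtain l where l: "x \<longlonglongrightarrow> l"
    using convergent_if_isolated_from_missing[OF isolated] .
  have mem: "l \<in> C j" if "(\<Sum>k. ennreal (index_weight (w k) j)) = \<infinity>" for j
    using limit_mem_if_infinite_weight[OF l _ that] isolated by blast
  then have "l \<in> \<Inter>(family C)"
    if "\<forall>j\<ge>1. C j \<noteq> UNIV \<longrightarrow> (\<Sum>k. ennreal (index_weight (w k) j)) = \<infinity>"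
    using that by (fastforce simp: family_def)
  with l mem show ?thesis by blast
qed

end
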